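(* Let $f_1,\dots,f_m:\mathbb{R}^n\to\mathbb{R}$ be continuously differentiable and let $\{x_k\}$ be an infinite sequence generated by the algorithm MFQNMO described in the context, with matrices $\{B_k\}$. Suppose that: (A) for every $z\in\mathbb{R}^n$ the level set $\{x\in\mathbb{R}^n: f_i(x)\le f_i(z)\ \text{for all } i\in[m]\}$ is bounded; (B) for each $i\in[m]$, $\nabla f_i$ is Lipschitz continuous on $\mathbb{R}^n$ with constant $L_i$; (C) there exist constants $0<a\le b$ such that $aI_n\preceq B_k\preceq bI_n$ for all $k\ge 0$. For $x\in\mathbb{R}^n$ let $d_{SD}(x)$ be the unique minimizer over $d\in\mathbb{R}^n$ of $\max_{i\in[m]}\nabla f_i(x)^\top d+\frac12\|d\|^2$, and write $d_{SD}^k=d_{SD}(x_k)$. Then: (i) $\liminf_{k\to\infty}\|d_{SD}^k\|=0$; (ii) every accumulation point of the sequence $\{x_k\}$ is Pareto critical.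
   Context: Setting: the unconstrained multiobjective problem $\min_{x\in\mathbb{R}^n} f(x)=(f_1(x),\dots,f_m(x))^\top$; $[m]=\{1,\dots,m\}$; $\Delta_m=\{\lambda\in\mathbb{R}^m:\lambda_i\ge 0,\ \sum_{i}\lambda_i=1\}$; $\|\cdot\|$ is the Euclidean norm and, for symmetric positive definite $B$, $\|x\|_B=\sqrt{x^\top Bx}$; $A\preceq B$ means $B-A$ is positive semidefinite. No convexity of the $f_i$ is assumed. A point $x$ is Pareto critical if for every $d\in\mathbb{R}^n$ there exists $i\in[m]$ with $\nabla f_i(x)^\top d\ge 0$. Put $\mathcal{D}(x,d)=\max_{i\in[m]}\nabla f_i(x)^\top d$. Algorithm MFQNMO. Fix $0<\sigma_1<\sigma_2<1$, $x_0\in\mathbb{R}^n$ and $B_0\succ 0$ symmetric. At iteration $k\ge 0$, given $x_k$ and $B_k$: (1) let $\lambda^k=(\lambda^k_1,\dots,\lambda^k_m)\in\Delta_m$ be a minimizer over $\lambda\in\Delta_m$ of $\frac12\big\|\sum_{i}\lambda_i\nabla f_i(x_k)\big\|^2_{B_k^{-1}}$, and set $d_k=-B_k^{-1}\sum_{i}\lambda^k_i\nabla f_i(x_k)$ (equivalently, $d_k$ is the unique minimizer over $d\in\mathbb{R}^n$ of $\max_{i\in[m]}\nabla f_i(x_k)^\top d+\frac12 d^\top B_kd$); (2) choose a step size $\alpha_k>0$ satisfying the Wolfe conditions $f_i(x_k+\alpha_kd_k)\le f_i(x_k)+\sigma_1\alpha_k\mathcal{D}(x_k,d_k)$ for all $i\in[m]$,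 and $\mathcal{D}(x_k+\alpha_kd_k,d_k)\ge\sigma_2\mathcal{D}(x_k,d_k)$; (3) set $x_{k+1}=x_k+\alpha_kd_k$, $s_k=x_{k+1}-x_k$, $y_k=\sum_{i}\lambda^k_i(\nabla f_i(x_{k+1})-\nabla f_i(x_k))$; (4) set $\eta_k=\dfrac{y_k^\top s_k}{\|s_k\|^2}$, $m_k=\max\{-\eta_k,0\}+\sum_{i}\lambda^k_i\,(f_i(x_k)-f_i(x_{k+1}))$, $\gamma_k=y_k+m_ks_k$; (5) update $B_{k+1}=B_k-\dfrac{B_ks_ks_k^\top B_k}{s_k^\top B_ks_k}+\dfrac{\gamma_k\gamma_k^\top}{\gamma_k^\top s_k}$. The algorithm is assumed to run indefinitely, i.e. no iterate $x_k$ is Pareto critical (so $d_k\neq 0$ and $s_k\ne 0$ for all $k$). *)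

theory Defs
  imports "HOL-Analysis.Analysis"
begin

text \<open>
  The space \<open>\<real>\<^sup>n\<close> is \<^typ>\<open>real ^ 'n\<close>, and the finite type \<open>'m\<close> plays the role of the index set
  \<open>[m]\<close>. A vector-valued objective is given by its components \<open>f i\<close>.
\<close>

text \<open>Only meaningful at points where \<open>f\<close> is differentiable.\<close>

definition grad :: "('a::euclidean_space \<Rightarrow> real) \<Rightarrow> 'a \<Rightarrow> 'a"
  where "grad f x = (THE D. GDERIV f x :> D)"

definition unit_simplex :: "(real ^ 'm::finite) set"
  where "unit_simplex = {l. (\<forall>i. 0 \<le> l $ i) \<and> (\<Sum>i\<in>UNIV. l $ i) = 1}"

definition positive_definite :: "real ^ 'n ^ 'n::finite \<Rightarrow> bool"
  where "positive_definite A \<longleftrightarrow> transpose A = A \<and> (\<forall>v. v \<noteq> 0 \<longrightarrow> 0 < v \<bullet> (A *v v))"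

definition positive_semidefinite :: "real ^ 'n ^ 'n::finite \<Rightarrow> bool"
  where "positive_semidefinite A \<longleftrightarrow> transpose A = A \<and> (\<forall>v. 0 \<le> v \<bullet> (A *v v))"

definition loewner_le :: "real ^ 'n ^ 'n::finite \<Rightarrow> real ^ 'n ^ 'n \<Rightarrow> bool"  (infix \<open>\<preceq>\<close> 50)
  where "A \<preceq> B \<longleftrightarrow> positive_semidefinite (B - A)"

definition matrix_norm :: "real ^ 'n ^ 'n::finite \<Rightarrow> real ^ 'n \<Rightarrow> real"
  where "matrix_norm B v = sqrt (v \<bullet> (B *v v))"

definition outer_product :: "real ^ 'n \<Rightarrow> real ^ 'n::finite \<Rightarrow> real ^ 'n ^ 'n"
  where "outer_product u v = (\<chi> i j. u $ i * v $ j)"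

definition pareto_critical :: "('m::finite \<Rightarrow> real ^ 'n::finite \<Rightarrow> real) \<Rightarrow> real ^ 'n \<Rightarrow> bool"
  where "pareto_critical f x \<longleftrightarrow> (\<forall>d. \<exists>i. 0 \<le> grad (f i) x \<bullet> d)"

definition max_slope :: "('m::finite \<Rightarrow> real ^ 'n::finite \<Rightarrow> real) \<Rightarrow> real ^ 'n \<Rightarrow> real ^ 'n \<Rightarrow> real"
  where "max_slope f x d = (MAX i. grad (f i) x \<bullet> d)"

definition steepest_descent :: "('m::finite \<Rightarrow> real ^ 'n::finite \<Rightarrow> real) \<Rightarrow> real ^ 'n \<Rightarrow> real ^ 'n"
  where "steepest_descent f x =
    (THE d. is_arg_min (\<lambda>d. max_slope f x d + (norm d)\<^sup>2 / 2) (\<lambda>_. True) d)"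

definition weighted_grad ::
    "('m::finite \<Rightarrow> real ^ 'n::finite \<Rightarrow> real) \<Rightarrow> real ^ 'm \<Rightarrow> real ^ 'n \<Rightarrow> real ^ 'n"
  where "weighted_grad f l x = (\<Sum>i\<in>UNIV. l $ i *\<^sub>R grad (f i) x)"

definition dual_solution ::
    "('m::finite \<Rightarrow> real ^ 'n::finite \<Rightarrow> real) \<Rightarrow> real ^ 'n \<Rightarrow> real ^ 'n ^ 'n \<Rightarrow> real ^ 'm \<Rightarrow> bool"
  where "dual_solution f x B l \<longleftrightarrow>
    is_arg_min (\<lambda>l. (matrix_norm (matrix_inv B) (weighted_grad f l x))\<^sup>2 / 2)
      (\<lambda>l. l \<in> unit_simplex) l"

definition direction ::
    "('m::finite \<Rightarrow> real ^ 'n::finite \<Rightarrow> real) \<Rightarrow> real ^ 'n \<Rightarrow> real ^ 'n ^ 'n \<Rightarrow> real ^ 'm \<Rightarrow> real ^ 'n"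
  where "direction f x B l = - (matrix_inv B *v weighted_grad f l x)"

definition wolfe ::
    "('m::finite \<Rightarrow> real ^ 'n::finite \<Rightarrow> real) \<Rightarrow> real \<Rightarrow> real \<Rightarrow> real ^ 'n \<Rightarrow> real ^ 'n \<Rightarrow> real \<Rightarrow> bool"
  where "wolfe f \<sigma>1 \<sigma>2 x d \<alpha> \<longleftrightarrow>
    (\<forall>i. f i (x + \<alpha> *\<^sub>R d) \<le> f i x + \<sigma>1 * \<alpha> * max_slope f x d) \<and>
    max_slope f (x + \<alpha> *\<^sub>R d) d \<ge> \<sigma>2 * max_slope f x d"

definition mfqn_update ::
    "('m::finite \<Rightarrow> real ^ 'n::finite \<Rightarrow> real) \<Rightarrow> real ^ 'm \<Rightarrow> real ^ 'n \<Rightarrow> real ^ 'n \<Rightarrow>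
      real ^ 'n ^ 'n \<Rightarrow> real ^ 'n ^ 'n"
  where "mfqn_update f l x x' B =
    (let s = x' - x;
         y = (\<Sum>i\<in>UNIV. l $ i *\<^sub>R (grad (f i) x' - grad (f i) x));
         \<eta> = (y \<bullet> s) / (norm s)\<^sup>2;
         \<mu> = max (- \<eta>) 0 + (\<Sum>i\<in>UNIV. l $ i * (f i x - f i x'));
         \<gamma> = y + \<mu> *\<^sub>R s
     in B - (1 / (s \<bullet> (B *v s))) *\<^sub>R (B ** outer_product s s ** B)
          + (1 / (\<gamma> \<bullet> s)) *\<^sub>R outer_product \<gamma> \<gamma>)"

text \<open>
  A run that never stops: \<open>x\<close>, \<open>B\<close>, \<open>l\<close> and \<open>\<alpha>\<close> are the sequences of iterates, matrices,
  multipliers and step sizes. Multipliers and step sizes need not be unique; any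
  admissible choice is allowed.
\<close>

definition mfqnmo_run ::
    "('m::finite \<Rightarrow> real ^ 'n::finite \<Rightarrow> real) \<Rightarrow> real \<Rightarrow> real \<Rightarrow> (nat \<Rightarrow> real ^ 'n) \<Rightarrow>
      (nat \<Rightarrow> real ^ 'n ^ 'n) \<Rightarrow> (nat \<Rightarrow> real ^ 'm) \<Rightarrow> (nat \<Rightarrow> real) \<Rightarrow> bool"
  where "mfqnmo_run f \<sigma>1 \<sigma>2 x B l \<alpha> \<longleftrightarrow>
    0 < \<sigma>1 \<and> \<sigma>1 < \<sigma>2 \<and> \<sigma>2 < 1 \<and> positive_definite (B 0) \<and>
    (\<forall>k. \<not> pareto_critical f (x k) \<and>
         dual_solution f (x k) (B k) (l k) \<and>
         0 < \<alpha> k \<and>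
         wolfe f \<sigma>1 \<sigma>2 (x k) (direction f (x k) (B k) (l k)) (\<alpha> k) \<and>
         x (Suc k) = x k + \<alpha> k *\<^sub>R direction f (x k) (B k) (l k) \<and>
         B (Suc k) = mfqn_update f (l k) (x k) (x (Suc k)) (B k))"

definition accumulation_point :: "(nat \<Rightarrow> 'a::topological_space) \<Rightarrow> 'a \<Rightarrow> bool"
  where "accumulation_point X z \<longleftrightarrow> (\<exists>r. strict_mono r \<and> (X \<circ> r) \<longlonglongrightarrow> z)"

end

theory Submission
  imports Defs
begin

text \<open>
  Why it holds. Write \<open>g\<^sub>k\<close> for the convex combination of the gradients at \<open>x\<^sub>k\<close> with weights
  \<open>\<lambda>\<^sup>k\<close>. The argument is that every iteration decreases each objective by at least a fixed
  multiple of \<open>\<parallel>g\<^sub>k\<parallel>\<^sup>2\<close>; as the objectives are bounded below on the initial level set, this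
  forces \<open>g\<^sub>k \<longlonglongrightarrow> 0\<close>, and a vanishing convex combination of gradients is a certificate of
  approximate Pareto criticality.

  The decrease comes from three estimates. The variational inequality of the dual problem
  (\<open>dual_solution_slope\<close>) says that all directional derivatives along \<open>d\<^sub>k\<close> are at most
  \<open>- d\<^sub>k \<bullet> B\<^sub>k d\<^sub>k\<close>. The curvature half of the Wolfe conditions, compared with the Lipschitz bound
  on the gradients, shows that such a slope cannot be flattened by too short a step, so \<open>\<alpha>\<^sub>k\<close>
  is bounded away from zero (\<open>curvature_condition_step_lower_bound\<close>; here the lower bound on
  \<open>B\<^sub>k\<close> enters). Finally the upper bound \<open>B\<^sub>k \<preceq> b I\<close> gives
  \<open>\<parallel>g\<^sub>k\<parallel>\<^sup>2 = \<parallel>B\<^sub>k d\<^sub>k\<parallel>\<^sup>2 \<le> b (d\<^sub>k \<bullet> B\<^sub>k d\<^sub>k)\<close>, so the decrease granted by the Armijo half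
  is measured by \<open>\<parallel>g\<^sub>k\<parallel>\<^sup>2\<close> (\<open>mfqnmo_sufficient_decrease\<close>).

  Both conclusions then follow from \<open>g\<^sub>k \<bullet> d \<le> \<D>(x\<^sub>k, d)\<close>. Applied to the steepest descent
  direction it yields \<open>\<parallel>d\<^sub>S\<^sub>D(x\<^sub>k)\<parallel> \<le> 2 \<parallel>g\<^sub>k\<parallel>\<close>, so that the whole sequence of norms tends to
  zero. Applied to a fixed \<open>d\<close> it yields \<open>\<D>(z, d) \<ge> 0\<close> at every accumulation point \<open>z\<close> by
  continuity of the gradients.
\<close>

section \<open>Matrices between multiples of the identity\<close>

lemma mat_mult_vector: "mat c *v v = c *\<^sub>R (v :: real ^ 'n::finite)"
  by (simp add: vec_eq_iff matrix_vector_mult_def mat_def if_distrib if_distribR cong: if_cong)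

lemma symmetric_matrix_inner:
  fixes B :: "real ^ 'n ^ 'n::finite"
  assumes "transpose B = B"
  shows "(B *v u) \<bullet> w = u \<bullet> (B *v w)"
  by (metis assms dot_lmul_matrix transpose_matrix_vector)

lemma transpose_diff: "transpose (A - B) = transpose A - transpose (B :: real ^ 'n ^ 'm)"
  by (simp add: transpose_def vec_eq_iff)

lemma mat_loewner_leD:
  assumes "mat a \<preceq> B"
  shows "transpose B = B" and "a * (norm v)\<^sup>2 \<le> v \<bullet> (B *v v)"
proof -
  have psd: "transpose (B - mat a) = B - mat a" "0 \<le> v \<bullet> ((B - mat a) *v v)"
    using assms by (auto simp: loewner_le_def positive_semidefinite_def)
  show "transpose B = B"
    using psd(1) by (simp add: transpose_diff transpose_mat)
  show "a * (norm v)\<^sup>2 \<le> v \<bullet> (B *v v)"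
    using psd(2)
    by (simp add: matrix_vector_mult_diff_rdistrib mat_mult_vector inner_diff_right
        power2_norm_eq_inner)
qed

lemma loewner_le_matD:
  assumes "B \<preceq> mat b"
  shows "v \<bullet> (B *v v) \<le> b * (norm v)\<^sup>2"
proof -
  have "0 \<le> v \<bullet> ((mat b - B) *v v)"
    using assms by (auto simp: loewner_le_def positive_semidefinite_def)
  then show ?thesis
    by (simp add: matrix_vector_mult_diff_rdistrib mat_mult_vector inner_diff_right
        power2_norm_eq_inner)
qed

lemma matrix_inv_mult_cancel:
  fixes B :: "real ^ 'n ^ 'n::finite"
  assumes "0 < a" "mat a \<preceq> B"
  shows "B *v (matrix_inv B *v g) = g"
proof -
  have "B *v v = 0 \<Longrightarrow> v = 0" for v
    using mat_loewner_leD(2)[OF assms(2), of v] assms(1)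
    by (simp add: mult_le_0_iff)
  then have "invertible B"
    by (metis invertible_left_inverse matrix_left_invertible_ker)
  then have "B ** matrix_inv B = mat 1"
    unfolding invertible_def matrix_inv_def by (rule someI_ex[THEN conjunct1])
  then show ?thesis
    by (simp add: matrix_vector_mul_assoc)
qed

text \<open>
  This is \<open>B\<^sup>2 \<preceq> b B\<close> for \<open>0 \<preceq> B \<preceq> b I\<close>. The quadratic form of \<open>B\<close> is nonnegative at
  \<open>v - B v / b\<close>, and the term cubic in \<open>B\<close> in its expansion is controlled by \<open>B \<preceq> b I\<close> at \<open>B v\<close>.
\<close>

lemma norm_matrix_vector_le_quadratic_form:
  fixes B :: "real ^ 'n ^ 'n::finite"
  assumes "0 \<le> a" "0 < b" "mat a \<preceq> B" "B \<preceq> mat b"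
  shows "(norm (B *v v))\<^sup>2 \<le> b * (v \<bullet> (B *v v))"
proof -
  define w where "w = B *v v"
  define u where "u = v - (1 / b) *\<^sub>R w"
  have "0 \<le> u \<bullet> (B *v u)"
    using mat_loewner_leD(2)[OF assms(3), of u] assms(1)
    by (meson mult_nonneg_nonneg order_trans zero_le_power2)
  also have "u \<bullet> (B *v u) = v \<bullet> w - 2 / b * (norm w)\<^sup>2 + (1 / b)\<^sup>2 * (w \<bullet> (B *v w))"
    using symmetric_matrix_inner[OF mat_loewner_leD(1)[OF assms(3)], of v w, symmetric]
    by (simp add: u_def w_def matrix_vector_mult_diff_distrib matrix_vector_mult_scaleR
        inner_diff_left inner_diff_right dot_square_norm power2_eq_square inner_commute diff_divide_distrib)
  also have "\<dots> \<le> v \<bullet> w - 2 / b * (norm w)\<^sup>2 + (1 / b)\<^sup>2 * (b * (norm w)\<^sup>2)"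
    using loewner_le_matD[OF assms(4), of w] by (simp add: mult_left_mono)
  also have "\<dots> = v \<bullet> w - (norm w)\<^sup>2 / b"
    using assms(2) by (simp add: field_simps power2_eq_square)
  finally show ?thesis
    using assms(2) by (simp add: w_def field_simps)
qed

section \<open>Slopes and convex combinations of gradients\<close>

lemma grad_inner_le_max_slope: "grad (f i) x \<bullet> d \<le> max_slope f x d"
  by (simp add: max_slope_def)

lemma max_slope_le_iff: "max_slope f x d \<le> c \<longleftrightarrow> (\<forall>i. grad (f i) x \<bullet> d \<le> c)"
  by (auto simp: max_slope_def)

lemma max_slope_less_iff: "max_slope f x d < c \<longleftrightarrow> (\<forall>i. grad (f i) x \<bullet> d < c)"
  by (auto simp: max_slope_def)

lemma pareto_critical_iff_max_slope: "pareto_critical f x \<longleftrightarrow> (\<forall>d. 0 \<le> max_slope f x d)"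
  by (auto simp: pareto_critical_def max_slope_less_iff simp flip: not_less)

lemma weighted_grad_inner_le_max_slope:
  assumes "l \<in> unit_simplex"
  shows "weighted_grad f l x \<bullet> d \<le> max_slope f x d"
proof -
  have l: "0 \<le> l $ i" "(\<Sum>i\<in>UNIV. l $ i) = 1" for i
    using assms by (auto simp: unit_simplex_def)
  have "weighted_grad f l x \<bullet> d = (\<Sum>i\<in>UNIV. l $ i * (grad (f i) x \<bullet> d))"
    by (simp add: weighted_grad_def inner_sum_left)
  also have "\<dots> \<le> (\<Sum>i\<in>UNIV. l $ i * max_slope f x d)"
    by (intro sum_mono mult_left_mono grad_inner_le_max_slope l)
  finally show ?thesis
    using l by (simp flip: sum_distrib_right)
qed

lemma axis_in_unit_simplex: "axis i 1 \<in> unit_simplex"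
  by (simp add: unit_simplex_def axis_def)

lemma weighted_grad_axis: "weighted_grad f (axis i 1) x = grad (f i) x"
  by (simp add: weighted_grad_def axis_def if_distrib if_distribR cong: if_cong)

lemma weighted_grad_segment:
  "weighted_grad f (l + t *\<^sub>R (l' - l)) x =
    weighted_grad f l x + t *\<^sub>R (weighted_grad f l' x - weighted_grad f l x)"
  by (simp add: weighted_grad_def algebra_simps sum.distrib sum_subtractf scaleR_sum_right)

lemma unit_simplex_segment:
  assumes "l \<in> unit_simplex" "l' \<in> unit_simplex" "0 \<le> t" "t \<le> 1"
  shows "l + t *\<^sub>R (l' - l) \<in> unit_simplex"
proof -
  have "0 \<le> l $ i + t * (l' $ i - l $ i)" for i
  proof -
    have "0 \<le> (1 - t) * l $ i + t * l' $ i"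
      using assms by (simp add: unit_simplex_def)
    then show ?thesis by (simp add: algebra_simps)
  qed
  then show ?thesis
    using assms
    by (simp add: unit_simplex_def sum.distrib sum_subtractf flip: sum_distrib_left)
qed

text \<open>
  The variational inequality of the dual problem: moving the weights from the minimizer towards
  the \<open>i\<close>-th vertex of the simplex cannot decrease the objective to first order, which says
  exactly that \<open>\<nabla>f\<^sub>i(x) \<bullet> B\<^sup>-\<^sup>1 g \<ge> g \<bullet> B\<^sup>-\<^sup>1 g\<close> for the optimal combination \<open>g\<close>.
\<close>

lemma dual_solution_slope:
  fixes f :: "'m::finite \<Rightarrow> real ^ 'n::finite \<Rightarrow> real"
  assumes "0 < a" "mat a \<preceq> B" and dual: "dual_solution f x B l"
  defines "d \<equiv> direction f x B l"
  shows "max_slope f x d \<le> - (d \<bullet> (B *v d))"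
proof -
  define g where "g = weighted_grad f l x"
  define P where "P = matrix_inv B"
  have BP: "B *v (P *v u) = u" for u
    unfolding P_def using assms(1,2) by (rule matrix_inv_mult_cancel)
  have symB: "(B *v u) \<bullet> w = u \<bullet> (B *v w)" for u w
    using mat_loewner_leD(1)[OF assms(2)] by (rule symmetric_matrix_inner)
  have symP: "(P *v u) \<bullet> w = u \<bullet> (P *v w)" for u w
    by (metis BP symB)
  have Ppos: "0 \<le> u \<bullet> (P *v u)" for u
  proof -
    have "0 \<le> a * (norm (P *v u))\<^sup>2"
      using assms(1) by simp
    also have "\<dots> \<le> (P *v u) \<bullet> u"
      using mat_loewner_leD(2)[OF assms(2), of "P *v u"] by (simp add: BP)
    finally show ?thesis by (simp add: inner_commute)
  qed
  have norm_P: "(matrix_norm P u)\<^sup>2 = u \<bullet> (P *v u)" for u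
    by (simp add: matrix_norm_def Ppos)
  have l: "l \<in> unit_simplex"
    and minimal: "\<And>l'. l' \<in> unit_simplex \<Longrightarrow>
      g \<bullet> (P *v g) \<le> weighted_grad f l' x \<bullet> (P *v weighted_grad f l' x)"
    using dual unfolding dual_solution_def is_arg_min_linorder norm_P[unfolded P_def]
    by (auto simp: g_def P_def)
  have slope: "grad (f i) x \<bullet> d \<le> - (g \<bullet> (P *v g))" for i
  proof -
    define h where "h = grad (f i) x - g"
    define r where "r = h \<bullet> (P *v g)"
    have quadratic: "0 \<le> 2 * r + t * (h \<bullet> (P *v h))" if t: "0 < t" "t \<le> 1" for t
    proof -
      have "g \<bullet> (P *v g) \<le> (g + t *\<^sub>R h) \<bullet> (P *v (g + t *\<^sub>R h))"
        using minimal[OF unit_simplex_segment[OF l axis_in_unit_simplex[of i], of t]] t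
        by (simp add: weighted_grad_segment weighted_grad_axis g_def h_def)
      also have "\<dots> = g \<bullet> (P *v g) + t * (2 * r + t * (h \<bullet> (P *v h)))"
        using symP[of h g]
        by (simp add: r_def matrix_vector_right_distrib matrix_vector_mult_scaleR
            inner_add_left inner_add_right inner_commute algebra_simps)
      finally show ?thesis
        using t by (simp add: zero_le_mult_iff)
    qed
    have "((\<lambda>t. 2 * r + t * (h \<bullet> (P *v h))) \<longlongrightarrow> 2 * r + 0 * (h \<bullet> (P *v h))) (at_right 0)"
      by (intro tendsto_intros)
    moreover have "eventually (\<lambda>t. 0 \<le> 2 * r + t * (h \<bullet> (P *v h))) (at_right 0)"
      using eventually_at_right_real[of 0 "1::real", OF zero_less_one]
      by eventually_elim (auto intro: quadratic)
    ultimately have "0 \<le> 2 * r + 0 * (h \<bullet> (P *v h))"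
      by (rule tendsto_lowerbound) simp
    then show ?thesis
      by (simp add: r_def h_def d_def direction_def g_def P_def inner_diff_left)
  qed
  have "d \<bullet> (B *v d) = g \<bullet> (P *v g)"
  proof -
    have "d = - (P *v g)"
      by (simp add: d_def direction_def g_def P_def)
    then have "B *v d = - g"
      using BP by (metis matrix_vector_mult_scaleR scaleR_minus1_left)
    then show ?thesis
      using \<open>d = - (P *v g)\<close> by (simp add: inner_commute)
  qed
  then show ?thesis
    using slope by (simp add: max_slope_le_iff)
qed

section \<open>The steepest descent direction\<close>

text \<open>
  The objective is continuous and positive outside a ball of radius \<open>2 \<parallel>g\<parallel>\<close>, because its
  nonsmooth part dominates the linear function \<open>g \<bullet> d\<close>; since it vanishes at the origin, it
  attains its minimum. The quadratic term makes it strictly convex, so the minimizer is unique.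
  The same comparison with the value at the origin bounds the norm of the minimizer.
\<close>

lemma norm_steepest_descent_le:
  fixes f :: "'m::finite \<Rightarrow> real ^ 'n::finite \<Rightarrow> real"
  assumes l: "l \<in> unit_simplex"
  shows "norm (steepest_descent f x) \<le> 2 * norm (weighted_grad f l x)"
proof -
  define g where "g = weighted_grad f l x"
  define \<phi> where "\<phi> = (\<lambda>d. max_slope f x d + (norm d)\<^sup>2 / 2)"
  have \<phi>0: "\<phi> 0 = 0"
    by (simp add: \<phi>_def max_slope_def)
  have small: "norm d \<le> 2 * norm g" if "\<phi> d \<le> 0" for d
  proof -
    have "- (norm g * norm d) \<le> g \<bullet> d"
      using Cauchy_Schwarz_ineq2[of g d] by linarith
    also have "\<dots> \<le> max_slope f x d"
      unfolding g_def using l by (rule weighted_grad_inner_le_max_slope)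
    finally have "norm d * norm d \<le> (2 * norm g) * norm d"
      using that by (simp add: \<phi>_def power2_eq_square)
    then show ?thesis
      by (cases "d = 0") auto
  qed
  have "continuous_on UNIV \<phi>"
  proof -
    have "continuous_on UNIV (\<lambda>d. MAX i\<in>A. grad (f i) x \<bullet> d)" if "finite A" "A \<noteq> {}" for A
      using that
    proof (induction rule: finite_ne_induct)
      case (insert i A)
      then have "(\<lambda>d. MAX i\<in>insert i A. grad (f i) x \<bullet> d) =
          (\<lambda>d. max (grad (f i) x \<bullet> d) (MAX i\<in>A. grad (f i) x \<bullet> d))"
        by simp
      then show ?case
        using insert.IH by (simp only:) (intro continuous_intros)
    qed (auto intro!: continuous_intros)
    then show ?thesis
      unfolding \<phi>_def max_slope_def by (intro continuous_intros) auto
  qed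
  then obtain e where e: "\<And>d. d \<in> cball 0 (2 * norm g) \<Longrightarrow> \<phi> e \<le> \<phi> d"
    using continuous_attains_inf[of "cball 0 (2 * norm g)" \<phi>]
    by (metis cball_eq_empty compact_cball continuous_on_subset linorder_not_less
        mult_nonneg_nonneg norm_ge_zero subset_UNIV zero_le_numeral)
  have e_min: "\<phi> e \<le> \<phi> d" for d
  proof (cases "\<phi> d \<le> 0")
    case True
    then show ?thesis using e small by simp
  next
    case False
    then show ?thesis using e[of 0] \<phi>0 by simp
  qed
  have unique: "d = e" if d: "\<And>c. \<phi> d \<le> \<phi> c" for d
  proof -
    define c where "c = (1 / 2) *\<^sub>R (d + e)"
    have "max_slope f x c \<le> (max_slope f x d + max_slope f x e) / 2"
      unfolding max_slope_le_iff
    proof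
      fix i
      show "grad (f i) x \<bullet> c \<le> (max_slope f x d + max_slope f x e) / 2"
        using grad_inner_le_max_slope[of f i x d] grad_inner_le_max_slope[of f i x e]
        by (simp add: c_def inner_add_right)
    qed
    moreover have "(norm c)\<^sup>2 = ((norm d)\<^sup>2 + (norm e)\<^sup>2) / 2 - (norm (d - e))\<^sup>2 / 4"
      by (simp add: c_def power2_norm_eq_inner inner_add_left inner_add_right inner_diff_left
          inner_diff_right inner_commute field_simps)
    ultimately have "\<phi> c \<le> (\<phi> d + \<phi> e) / 2 - (norm (d - e))\<^sup>2 / 8"
      by (simp add: \<phi>_def field_simps)
    moreover have "(\<phi> d + \<phi> e) / 2 \<le> \<phi> c"
      using d[of c] e_min[of c] by simp
    ultimately have "(norm (d - e))\<^sup>2 / 8 \<le> 0"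
      by (simp only: le_diff_eq)
    then show ?thesis by simp
  qed
  have "steepest_descent f x = e"
    unfolding steepest_descent_def \<phi>_def[symmetric] is_arg_min_linorder
    by (rule the_equality) (auto intro: e_min unique)
  then show ?thesis
    using small[of e] e_min[of 0] \<phi>0 by (simp add: g_def)
qed

section \<open>Decrease along a Wolfe step\<close>

lemma max_slope_lipschitz:
  fixes f :: "'m::finite \<Rightarrow> real ^ 'n::finite \<Rightarrow> real"
  assumes "\<And>i. K-lipschitz_on UNIV (grad (f i))"
  shows "max_slope f x' d \<le> max_slope f x d + K * norm (x' - x) * norm d"
  unfolding max_slope_le_iff
proof
  fix i
  have "grad (f i) x' \<bullet> d = grad (f i) x \<bullet> d + (grad (f i) x' - grad (f i) x) \<bullet> d"
    by (simp add: inner_diff_left)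
  also have "\<dots> \<le> max_slope f x d + norm (grad (f i) x' - grad (f i) x) * norm d"
    by (intro add_mono grad_inner_le_max_slope norm_cauchy_schwarz)
  also have "\<dots> \<le> max_slope f x d + K * norm (x' - x) * norm d"
    using lipschitz_onD[OF assms, of x' x i]
    by (intro add_left_mono mult_right_mono) (auto simp: dist_norm)
  finally show "grad (f i) x' \<bullet> d \<le> max_slope f x d + K * norm (x' - x) * norm d" .
qed

text \<open>
  The curvature condition requires the slope along \<open>d\<close> to increase by \<open>(1 - \<sigma>2) a \<parallel>d\<parallel>\<^sup>2\<close> at
  least, while the Lipschitz bound allows an increase of \<open>K \<alpha> \<parallel>d\<parallel>\<^sup>2\<close> at most.
\<close>

lemma curvature_condition_step_lower_bound:
  fixes f :: "'m::finite \<Rightarrow> real ^ 'n::finite \<Rightarrow> real"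
  assumes "\<And>i. K-lipschitz_on UNIV (grad (f i))"
    and "\<sigma>2 < 1" "0 < \<alpha>" "d \<noteq> 0"
    and "max_slope f x d \<le> - (a * (norm d)\<^sup>2)"
    and "\<sigma>2 * max_slope f x d \<le> max_slope f (x + \<alpha> *\<^sub>R d) d"
  shows "(1 - \<sigma>2) * a \<le> K * \<alpha>"
proof -
  have "(1 - \<sigma>2) * (a * (norm d)\<^sup>2) \<le> (1 - \<sigma>2) * (- max_slope f x d)"
    using assms by (intro mult_left_mono) auto
  also have "\<dots> \<le> K * norm ((x + \<alpha> *\<^sub>R d) - x) * norm d"
    using max_slope_lipschitz[of K f "x + \<alpha> *\<^sub>R d" d x] assms(1) assms(6)
    by (simp add: algebra_simps)
  also have "\<dots> = K * \<alpha> * (norm d)\<^sup>2"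
    using assms(3) by (simp add: power2_eq_square)
  finally show ?thesis
    using assms(4) by (simp flip: mult.assoc)
qed

lemma mfqnmo_sufficient_decrease:
  fixes f :: "'m::finite \<Rightarrow> real ^ 'n::finite \<Rightarrow> real"
  assumes run: "mfqnmo_run f \<sigma>1 \<sigma>2 x B l \<alpha>"
    and lipschitz: "\<And>i. K-lipschitz_on UNIV (grad (f i))"
    and bounds: "0 < a" "a \<le> b" "\<And>k. mat a \<preceq> B k \<and> B k \<preceq> mat b"
  obtains c where "0 < c"
    and "\<And>i k. f i (x (Suc k)) \<le> f i (x k) - c * (norm (weighted_grad f (l k) (x k)))\<^sup>2"
proof -
  have \<sigma>: "0 < \<sigma>1" "\<sigma>2 < 1"
    using run by (auto simp: mfqnmo_run_def)
  define d where "d k = direction f (x k) (B k) (l k)" for k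
  define g where "g k = weighted_grad f (l k) (x k)" for k
  define q where "q k = d k \<bullet> (B k *v d k)" for k
  note run_k = run[unfolded mfqnmo_run_def, THEN conjunct2, THEN conjunct2, THEN conjunct2,
      THEN conjunct2, rule_format]
  have slope: "max_slope f (x k) (d k) \<le> - q k" for k
    unfolding q_def d_def using bounds(1,3) run_k[of k] by (intro dual_solution_slope) auto
  have q_lower: "a * (norm (d k))\<^sup>2 \<le> q k" for k
    unfolding q_def using bounds(3) by (intro mat_loewner_leD) auto
  have gd: "B k *v d k = - g k" for k
    using matrix_inv_mult_cancel[OF bounds(1), of "B k"] bounds(3)
    by (metis d_def g_def direction_def matrix_vector_mult_scaleR scaleR_minus1_left)
  have q_upper: "(norm (g k))\<^sup>2 \<le> b * q k" for k
    using norm_matrix_vector_le_quadratic_form[of a b "B k" "d k"] bounds(1,2) bounds(3)[of k]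
    by (simp add: gd q_def)
  have d_nonzero: "d k \<noteq> 0" for k
  proof
    assume "d k = 0"
    then have "g k = 0"
      using gd[of k] by simp
    moreover have "l k \<in> unit_simplex"
      using run_k[of k] by (simp add: dual_solution_def is_arg_min_def)
    ultimately have "pareto_critical f (x k)"
      using weighted_grad_inner_le_max_slope[of "l k" f "x k"]
      by (simp add: g_def pareto_critical_iff_max_slope)
    then show False
      using run_k[of k] by simp
  qed
  have step: "(1 - \<sigma>2) * a \<le> K * \<alpha> k" for k
  proof (rule curvature_condition_step_lower_bound[OF lipschitz \<sigma>(2)])
    show "max_slope f (x k) (d k) \<le> - (a * (norm (d k))\<^sup>2)"
      using slope[of k] q_lower[of k] by linarith
  qed (use run_k[of k] d_nonzero in \<open>auto simp: wolfe_def d_def\<close>)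
  have "0 < K"
  proof -
    have "0 < K * \<alpha> 0"
      using step[of 0] \<sigma>(2) bounds(1) by (smt (verit) mult_pos_pos)
    then show ?thesis
      using run_k[of 0] by (simp add: zero_less_mult_iff)
  qed
  define \<tau> where "\<tau> = (1 - \<sigma>2) * a / K"
  have \<tau>: "0 < \<tau>" "\<tau> \<le> \<alpha> k" for k
    using step[of k] \<open>0 < K\<close> \<sigma>(2) bounds(1) by (auto simp: \<tau>_def field_simps)
  have "0 < \<sigma>1 * \<tau> / b"
    using \<sigma>(1) \<tau>(1) bounds(1,2) by simp
  moreover have "f i (x (Suc k)) \<le> f i (x k) - \<sigma>1 * \<tau> / b * (norm (g k))\<^sup>2" for i k
  proof -
    have "\<sigma>1 * \<tau> / b * (norm (g k))\<^sup>2 \<le> \<sigma>1 * \<tau> / b * (b * q k)"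
      using q_upper \<open>0 < \<sigma>1 * \<tau> / b\<close> by (intro mult_left_mono) auto
    also have "\<dots> = \<sigma>1 * (\<tau> * q k)"
      using bounds(1,2) by simp
    also have "\<dots> \<le> \<sigma>1 * (\<alpha> k * q k)"
      using \<tau>(2)[of k] \<sigma>(1) q_lower[of k] bounds(1)
      by (intro mult_left_mono mult_right_mono) (auto intro: order_trans[rotated])
    also have "\<dots> \<le> \<sigma>1 * (\<alpha> k * (- max_slope f (x k) (d k)))"
      using slope[of k] \<sigma>(1) run_k[of k] by (intro mult_left_mono) auto
    finally show ?thesis
      using run_k[of k] by (auto simp: wolfe_def d_def algebra_simps dest!: spec[of _ i])
  qed
  ultimately show thesis
    using that unfolding g_def by blast
qed

text \<open>The value sequence is decreasing and bounded below, so its decrements tend to zero.\<close>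

lemma decrease_bounded_below_imp_null:
  fixes v e :: "nat \<Rightarrow> real"
  assumes "\<And>k. v (Suc k) \<le> v k - e k" "\<And>k. 0 \<le> e k" "\<And>k. C \<le> v k"
  shows "e \<longlonglongrightarrow> 0"
proof -
  have "decseq v"
    using assms(1,2) by (intro decseq_SucI) (smt (verit))
  then obtain y where y: "v \<longlonglongrightarrow> y"
    using decseq_convergent[of v C] assms(3) by blast
  have "(\<lambda>k. v k - v (Suc k)) \<longlonglongrightarrow> y - y"
    by (intro tendsto_diff y LIMSEQ_Suc)
  then have "(\<lambda>k. v k - v (Suc k)) \<longlonglongrightarrow> 0" by simp
  then show ?thesis
    by (rule tendsto_sandwich[OF _ _ tendsto_const, rotated 2])
      (use assms(1,2) in \<open>auto intro!: always_eventually simp: le_diff_eq add.commute\<close>)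
qed

lemma mfqnmo_weighted_grad_null:
  fixes f :: "'m::finite \<Rightarrow> real ^ 'n::finite \<Rightarrow> real"
  assumes run: "mfqnmo_run f \<sigma>1 \<sigma>2 x B l \<alpha>"
    and continuous: "\<And>i. continuous_on UNIV (f i)"
    and bounded: "bounded {u. \<forall>i. f i u \<le> f i (x 0)}"
    and lipschitz: "\<And>i. K-lipschitz_on UNIV (grad (f i))"
    and bounds: "0 < a" "a \<le> b" "\<And>k. mat a \<preceq> B k \<and> B k \<preceq> mat b"
  shows "(\<lambda>k. weighted_grad f (l k) (x k)) \<longlonglongrightarrow> 0"
proof -
  define g where "g k = weighted_grad f (l k) (x k)" for k
  obtain c where c: "0 < c" "\<And>i k. f i (x (Suc k)) \<le> f i (x k) - c * (norm (g k))\<^sup>2"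
    using mfqnmo_sufficient_decrease[OF run lipschitz bounds] unfolding g_def by metis
  define S where "S = {u. \<forall>i. f i u \<le> f i (x 0)}"
  have x_in_S: "x k \<in> S" for k
  proof (induction k)
    case (Suc k)
    have "f i (x (Suc k)) \<le> f i (x k)" for i
      using c(2)[of i k] c(1) by (smt (verit) mult_nonneg_nonneg zero_le_power2)
    then show ?case
      using Suc unfolding S_def by (auto intro: order_trans)
  qed (simp add: S_def)
  fix i0 :: 'm
  have "compact (f i0 ` closure S)"
    using bounded continuous[of i0] unfolding S_def
    by (intro compact_continuous_image) (auto intro: continuous_on_subset)
  then obtain C where C: "\<And>u. u \<in> closure S \<Longrightarrow> C \<le> f i0 u"
    using compact_imp_bounded bounded_imp_bdd_below unfolding bdd_below_def by (metis imageI)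
  have "(\<lambda>k. c * (norm (g k))\<^sup>2) \<longlonglongrightarrow> 0"
  proof (rule decrease_bounded_below_imp_null)
    show "f i0 (x (Suc k)) \<le> f i0 (x k) - c * (norm (g k))\<^sup>2" for k
      by (rule c(2))
    show "C \<le> f i0 (x k)" for k
      using C x_in_S closure_subset by blast
  qed (use c(1) in simp)
  then have "(\<lambda>k. (norm (g k))\<^sup>2) \<longlonglongrightarrow> 0"
    using c(1) tendsto_mult_left_iff[of c "\<lambda>k. (norm (g k))\<^sup>2" 0 sequentially] by simp
  then have "(\<lambda>k. sqrt ((norm (g k))\<^sup>2)) \<longlonglongrightarrow> sqrt 0"
    by (rule tendsto_real_sqrt)
  then show ?thesis
    by (simp add: tendsto_norm_zero_iff g_def)
qed

section \<open>Convergence\<close>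

text \<open>
  A common descent direction \<open>d\<close> at the limit would, by continuity, keep all slopes along \<open>d\<close> at
  the later points below a negative constant. The same would then hold for the slopes of their
  convex combinations, which tend to zero.
\<close>

lemma pareto_critical_limit:
  fixes f :: "'m::finite \<Rightarrow> real ^ 'n::finite \<Rightarrow> real"
  assumes continuous: "\<And>i. continuous_on UNIV (grad (f i))"
    and u: "u \<longlonglongrightarrow> z"
    and simplex: "\<And>k. l k \<in> unit_simplex"
    and null: "(\<lambda>k. weighted_grad f (l k) (u k)) \<longlonglongrightarrow> 0"
  shows "pareto_critical f z"
proof (rule ccontr)
  assume "\<not> pareto_critical f z"
  then obtain d where d: "max_slope f z d < 0"
    by (auto simp: pareto_critical_iff_max_slope not_le)
  obtain c where c: "max_slope f z d < c" "c < 0"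
    using dense[OF d] by blast
  have "eventually (\<lambda>k. grad (f i) (u k) \<bullet> d < c) sequentially" for i
  proof -
    have "(\<lambda>k. grad (f i) (u k) \<bullet> d) \<longlonglongrightarrow> grad (f i) z \<bullet> d"
      using continuous[of i] u
      by (intro tendsto_intros) (auto intro: continuous_on_tendsto_compose)
    then show ?thesis
      using c(1) by (intro order_tendstoD) (auto simp: max_slope_less_iff)
  qed
  then have "eventually (\<lambda>k. max_slope f (u k) d < c) sequentially"
    by (simp add: max_slope_less_iff eventually_all_finite)
  then have "eventually (\<lambda>k. weighted_grad f (l k) (u k) \<bullet> d \<le> c) sequentially"
    by eventually_elim
      (meson weighted_grad_inner_le_max_slope[OF simplex] less_imp_le order_trans)
  moreover have "(\<lambda>k. weighted_grad f (l k) (u k) \<bullet> d) \<longlonglongrightarrow> 0 \<bullet> d"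
    by (intro tendsto_intros null)
  ultimately have "0 \<bullet> d \<le> c"
    by (intro tendsto_upperbound) auto
  then show False
    using c(2) by simp
qed

theorem theorem4p2:
  fixes f :: "'m::finite \<Rightarrow> real ^ 'n::finite \<Rightarrow> real"
    and \<sigma>1 \<sigma>2 a b :: real
    and L :: "'m \<Rightarrow> real"
    and x :: "nat \<Rightarrow> real ^ 'n"
    and B :: "nat \<Rightarrow> real ^ 'n ^ 'n"
    and l :: "nat \<Rightarrow> real ^ 'm"
    and \<alpha> :: "nat \<Rightarrow> real"
  assumes differentiable: "\<And>i z. f i differentiable (at z)"
    and continuous_grad: "\<And>i. continuous_on UNIV (grad (f i))"
    and run: "mfqnmo_run f \<sigma>1 \<sigma>2 x B l \<alpha>"
    and bounded_level_sets: "\<And>z. bounded {u. \<forall>i. f i u \<le> f i z}"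
    and lipschitz_grad: "\<And>i. (L i)-lipschitz_on UNIV (grad (f i))"
    and bounds: "0 < a" "a \<le> b" "\<And>k. mat a \<preceq> B k \<and> B k \<preceq> mat b"
  shows "liminf (\<lambda>k. ereal (norm (steepest_descent f (x k)))) = 0
    \<and> (\<forall>z. accumulation_point x z \<longrightarrow> pareto_critical f z)"
proof -
  have simplex: "l k \<in> unit_simplex" for k
    using run by (simp add: mfqnmo_run_def dual_solution_def is_arg_min_def)
  have "continuous_on UNIV (f i)" for i
    using differentiable
    by (auto simp: continuous_on_eq_continuous_at intro: differentiable_imp_continuous_within)
  moreover have "(Max (range L))-lipschitz_on UNIV (grad (f i))" for i
    by (rule lipschitz_on_le[OF lipschitz_grad]) simp
  ultimately have null: "(\<lambda>k. weighted_grad f (l k) (x k)) \<longlonglongrightarrow> 0"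
    by (intro mfqnmo_weighted_grad_null[OF run _ bounded_level_sets _ bounds])
  have "(\<lambda>k. 2 * norm (weighted_grad f (l k) (x k))) \<longlonglongrightarrow> 0"
    using tendsto_mult_right_zero[OF tendsto_norm_zero[OF null]] .
  then have "(\<lambda>k. norm (steepest_descent f (x k))) \<longlonglongrightarrow> 0"
    by (rule tendsto_sandwich[OF _ _ tendsto_const, rotated 2])
      (auto intro!: always_eventually norm_steepest_descent_le simplex)
  then have "(\<lambda>k. ereal (norm (steepest_descent f (x k)))) \<longlonglongrightarrow> ereal 0"
    by (rule tendsto_ereal)
  then have "liminf (\<lambda>k. ereal (norm (steepest_descent f (x k)))) = 0"
    by (simp add: lim_imp_Liminf zero_ereal_def)
  moreover have "pareto_critical f z" if accumulation: "accumulation_point x z" for z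
  proof -
    obtain r where r: "strict_mono r" "(x \<circ> r) \<longlonglongrightarrow> z"
      using accumulation by (auto simp: accumulation_point_def)
    have "(\<lambda>k. weighted_grad f (l (r k)) ((x \<circ> r) k)) \<longlonglongrightarrow> 0"
      using LIMSEQ_subseq_LIMSEQ[OF null r(1)] by (simp add: o_def)
    then show ?thesis
      by (rule pareto_critical_limit[OF continuous_grad r(2) simplex])
  qed
  ultimately show ?thesis by blast
qed

end
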